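(* Let $W$ be a Banach space and $V=W^*$; write $(V,\|\cdot\|)$ for $V$ with the norm topology and $(V,w^* )$ for $V$ with the weak$^*$ topology. Let $X$ be a connected, locally connected, Hausdorff, first countable, normal topological space and $f:X\to V$ a map such that $f:X\to(V,\|\cdot\|)$ is continuous, has local convexity data and is locally fiber connected, and $f:X\to(V,w^* )$ is closed. Then: (i) all fibers of $f$ are connected; (ii) $f:X\to(V,w^* )$ is open onto its image; (iii) the image $f(X)$ is a closed convex subset of $(V,w^* )$.
   Context: Local convexity data and local fiber connectedness are taken with respect to the norm topology of $V$. A subset $C\subset V$ is a cone with vertex $v_0$ if $v_0\in C$ and $(1-\lambda)v_0+\lambda v\in C$ for every $\lambda\ge 0$ and every $v\in C$, $v\ne v_0$; it is a convex cone if it is moreover convex. A continuous map $f:X\to V$ has local convexity data if for each $x\in X$ and every sufficiently small open neighborhood $U_x$ of $x$ there is a convex cone $C_x\subset V$ with vertex $f(x)$, endowed with the subspace topology from $V$, such that (VN) $f(U_x)\subset C_x$ and $f(U_x)$ is a neighborhood of $f(x)$ in $C_x$; and (SLO) $f|_{U_x}:U_x\to C_x$ is an open map, and for every neighborhood $U'_x\subset U_x$ of $x$ the set $f(U'_x)$ is a neighborhood of $f(x)$ in $C_x$. A subset $A\subset X$ satisfies condition (LFC) if for every $a\in A$, the set $A$ does not intersect two different connected components of the fiber $f^{-1}(f(a))$. The map $f$ is locally fiber connected if for every $x\in X$, every open neighborhood of $x$ contains a neighborhood $U_x$ of $x$ satisfying (LFC). "Open onto its image" means open as a map onto $f(X)$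 with the subspace topology. *)

theory Defs
  imports "HOL-Analysis.Analysis"
begin

text \<open>The dual V = W* of a Banach space W is modelled as the type of bounded
linear functionals W \<Rightarrow>L real; its euclidean topology is the norm topology.\<close>

definition weak_star_topology :: "('w::real_normed_vector \<Rightarrow>\<^sub>L real) topology" where
  "weak_star_topology =
     topology_generated_by {{v. blinfun_apply v w \<in> U} | w U. open U}"

definition nhd_in :: "'v::real_normed_vector set \<Rightarrow> 'v set \<Rightarrow> 'v \<Rightarrow> bool" where
  "nhd_in C S p \<longleftrightarrow> S \<subseteq> C \<and> (\<exists>T. open T \<and> p \<in> T \<and> T \<inter> C \<subseteq> S)"

definition is_cone_with_vertex :: "'v::real_vector set \<Rightarrow> 'v \<Rightarrow> bool" where
  "is_cone_with_vertex C v0 \<longleftrightarrow> v0 \<in> C \<and>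
     (\<forall>l v. l \<ge> 0 \<and> v \<in> C \<and> v \<noteq> v0 \<longrightarrow> (1 - l) *\<^sub>R v0 + l *\<^sub>R v \<in> C)"

definition is_convex_cone_with_vertex :: "'v::real_vector set \<Rightarrow> 'v \<Rightarrow> bool" where
  "is_convex_cone_with_vertex C v0 \<longleftrightarrow> is_cone_with_vertex C v0 \<and> convex C"

definition nhd_of :: "'a topology \<Rightarrow> 'a set \<Rightarrow> 'a \<Rightarrow> bool" where
  "nhd_of X N x \<longleftrightarrow> (\<exists>G. openin X G \<and> x \<in> G \<and> G \<subseteq> N)"

definition local_convexity_data ::
  "'a topology \<Rightarrow> ('a \<Rightarrow> 'v::real_normed_vector) \<Rightarrow> bool" where
  "local_convexity_data X f \<longleftrightarrow>
     (\<forall>x \<in> topspace X. \<exists>N. openin X N \<and> x \<in> N \<and>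
        (\<forall>U. openin X U \<and> x \<in> U \<and> U \<subseteq> N \<longrightarrow>
           (\<exists>C. is_convex_cone_with_vertex C (f x) \<and>
                 \<comment> \<open>(VN)\<close>
                 f ` U \<subseteq> C \<and> nhd_in C (f ` U) (f x) \<and>
                 \<comment> \<open>(SLO)\<close>
                 (\<forall>G. openin (subtopology X U) G \<longrightarrow>
                        openin (subtopology euclidean C) (f ` G)) \<and>
                 (\<forall>U'. U' \<subseteq> U \<and> nhd_of X U' x \<longrightarrow> nhd_in C (f ` U') (f x)))))"

definition fiber :: "'a topology \<Rightarrow> ('a \<Rightarrow> 'v) \<Rightarrow> 'v \<Rightarrow> 'a set" where
  "fiber X f v = {y \<in> topspace X. f y = v}"

definition LFC :: "'a topology \<Rightarrow> ('a \<Rightarrow> 'v) \<Rightarrow> 'a set \<Rightarrow> bool" where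
  "LFC X f A \<longleftrightarrow>
     (\<forall>a \<in> A. \<forall>K1 \<in> connected_components_of (subtopology X (fiber X f (f a))).
        \<forall>K2 \<in> connected_components_of (subtopology X (fiber X f (f a))).
          K1 \<inter> A \<noteq> {} \<and> K2 \<inter> A \<noteq> {} \<longrightarrow> K1 = K2)"

definition locally_fiber_connected :: "'a topology \<Rightarrow> ('a \<Rightarrow> 'v) \<Rightarrow> bool" where
  "locally_fiber_connected X f \<longleftrightarrow>
     (\<forall>x \<in> topspace X. \<forall>G. openin X G \<and> x \<in> G \<longrightarrow>
        (\<exists>U. U \<subseteq> G \<and> nhd_of X U x \<and> LFC X f U))"

end

theory Submission
  imports Defs
begin

text \<open>A weak-star closed map is norm closed, so the work takes place in the norm topology. Modulo
components of fibers, \<open>X\<close> is covered by open sets that \<open>f\<close> maps injectively and openly onto convex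
sets, and local sections are unique because \<open>X\<close> is normal and \<open>f\<close> is closed. Call \<open>x\<close> and \<open>y\<close>
linked if the segment from \<open>f x\<close> to \<open>f y\<close> lifts to a segment from \<open>x\<close> to \<open>y\<close>; equivalently, \<open>x\<close> and
\<open>y\<close> lie in the same quasi-component of the preimage of that segment. The second form shows that the
set of points linked to \<open>a\<close> is closed. The first shows, by a Tietze-Nakajima type argument (tilting
a lifted segment inside the local convex images), that it is open. As \<open>X\<close> is connected, any two
points are linked. For two points of the same fiber the segment is degenerate, which makes fibers
connected; and the image contains all segments between its points. With connected fibers, the
saturation \<open>f -` f ` U\<close> of an open set is open and \<open>f\<close> maps its complement to a weak-star closed
set, which gives openness.\<close>

subsection \<open>Components of fibers\<close>

text \<open>The witness is a connected set on which \<open>f\<close> is constant, not a component of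
  a subspace, so that it can be passed directly to \<open>connectedinD\<close>.\<close>

definition same_fiber_component :: "'a topology \<Rightarrow> ('a \<Rightarrow> 'v) \<Rightarrow> 'a \<Rightarrow> 'a \<Rightarrow> bool" where
  "same_fiber_component X f u w \<longleftrightarrow>
     (\<exists>T. connectedin X T \<and> u \<in> T \<and> w \<in> T \<and> (\<forall>z\<in>T. f z = f u))"

lemma same_fiber_component_iff:
  "same_fiber_component X f u w \<longleftrightarrow>
     connected_component_of (subtopology X (fiber X f (f u))) u w"
proof -
  have "T \<subseteq> fiber X f (f u) \<longleftrightarrow> (\<forall>z\<in>T. f z = f u)" if "connectedin X T" for T
    using connectedin_subset_topspace[OF that] by (auto simp: fiber_def)
  then show ?thesis
    unfolding same_fiber_component_def connected_component_of_def connectedin_subtopology by blast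
qed

lemma same_fiber_component_refl: "u \<in> topspace X \<Longrightarrow> same_fiber_component X f u u"
  by (auto simp: same_fiber_component_iff fiber_def connected_component_of_refl)

lemma same_fiber_component_eq: "same_fiber_component X f u w \<Longrightarrow> f w = f u"
  by (auto simp: same_fiber_component_def)

lemma same_fiber_component_topspace:
  "same_fiber_component X f u w \<Longrightarrow> u \<in> topspace X \<and> w \<in> topspace X"
  unfolding same_fiber_component_def by (metis connectedin_subset_topspace subsetD)

lemma same_fiber_component_sym:
  "same_fiber_component X f u w \<Longrightarrow> same_fiber_component X f w u"
  unfolding same_fiber_component_def by metis

lemma same_fiber_component_trans:
  "same_fiber_component X f u w \<Longrightarrow> same_fiber_component X f w z \<Longrightarrow> same_fiber_component X f u z"
  by (metis same_fiber_component_iff same_fiber_component_eq connected_component_of_trans)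

lemma LFC_same_fiber_component:
  assumes "LFC X f A" "u \<in> A" "w \<in> A" "u \<in> topspace X" "w \<in> topspace X" "f u = f w"
  shows "same_fiber_component X f u w"
proof -
  let ?F = "subtopology X (fiber X f (f u))"
  let ?K = "\<lambda>z. connected_component_of_set ?F z"
  have uw: "u \<in> topspace ?F" "w \<in> topspace ?F"
    using assms by (auto simp: fiber_def)
  then have "?K u \<in> connected_components_of ?F" "?K w \<in> connected_components_of ?F"
    by (simp_all add: connected_component_in_connected_components_of)
  moreover have "u \<in> ?K u" "w \<in> ?K w"
    using uw by (simp_all add: connected_component_of_refl)
  ultimately have "?K u = ?K w"
    using assms(1)[unfolded LFC_def, rule_format, OF assms(2), of "?K u" "?K w"] assms(2,3) by blast
  then show ?thesis
    using \<open>w \<in> ?K w\<close> by (auto simp: same_fiber_component_iff)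
qed

subsection \<open>Segments in convex sets\<close>

lemma convex_add_scaleR:
  fixes p v :: "'v::real_vector"
  assumes "convex S" "p \<in> S" "p + t *\<^sub>R v \<in> S" "0 \<le> s" "s \<le> t"
  shows "p + s *\<^sub>R v \<in> S"
proof (cases "t = 0")
  case False
  then have "(1 - s / t) *\<^sub>R p + (s / t) *\<^sub>R (p + t *\<^sub>R v) \<in> S"
    using assms by (intro convexD_alt) auto
  then show ?thesis
    using False by (simp add: algebra_simps)
qed (use assms in auto)

lemma openin_segment_initial:
  fixes p h :: "'v::real_normed_vector"
  assumes "openin (top_of_set S) T" "convex S" "p \<in> T" "p + h \<in> S"
  obtains \<epsilon> where "0 < \<epsilon>" "\<epsilon> \<le> 1" "\<And>\<theta>. 0 \<le> \<theta> \<Longrightarrow> \<theta> \<le> \<epsilon> \<Longrightarrow> p + \<theta> *\<^sub>R h \<in> T"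
proof -
  obtain e where e: "e > 0" "\<And>q. q \<in> S \<Longrightarrow> dist q p < e \<Longrightarrow> q \<in> T"
    using assms by (auto simp: openin_euclidean_subtopology_iff)
  \<comment> \<open>The summand 1 keeps the bound positive when \<open>h = 0\<close> and makes
    \<open>\<theta> * norm h\<close> strictly smaller than \<open>e\<close>.\<close>
  define \<epsilon> where "\<epsilon> = min 1 (e / (norm h + 1))"
  have "p \<in> S"
    using assms openin_imp_subset by blast
  show ?thesis
  proof
    show "0 < \<epsilon>" "\<epsilon> \<le> 1"
      using e by (auto simp: \<epsilon>_def add_nonneg_pos)
    fix \<theta> :: real assume \<theta>: "0 \<le> \<theta>" "\<theta> \<le> \<epsilon>"
    have "p + \<theta> *\<^sub>R h \<in> S"
      using \<theta> \<open>\<epsilon> \<le> 1\<close> \<open>p \<in> S\<close> assms convex_add_scaleR[of S p 1 h \<theta>] by simp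
    moreover have "\<theta> * norm h < e"
    proof -
      have "\<theta> * norm h \<le> e / (norm h + 1) * norm h"
        using \<theta> by (intro mult_right_mono) (auto simp: \<epsilon>_def)
      also have "\<dots> < e"
        using e by (simp add: divide_less_eq add_nonneg_pos)
      finally show ?thesis .
    qed
    ultimately show "p + \<theta> *\<^sub>R h \<in> T"
      using e \<theta> by (simp add: dist_norm)
  qed
qed

subsection \<open>Saturated charts\<close>

text \<open>Openness is relative to the image, which may have empty interior in the whole space. Up
  to fiber components, \<open>f\<close> is an open injection of \<open>U\<close> onto a convex
  set.\<close>

definition chart :: "'a topology \<Rightarrow> ('a \<Rightarrow> 'v::real_normed_vector) \<Rightarrow> 'a set \<Rightarrow> bool" where
  "chart X f U \<longleftrightarrow> openin X U \<and> convex (f ` U) \<and>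
     (\<forall>G. openin X G \<and> G \<subseteq> U \<longrightarrow> openin (top_of_set (f ` U)) (f ` G)) \<and>
     (\<forall>u\<in>U. \<forall>w\<in>U. f u = f w \<longrightarrow> same_fiber_component X f u w)"

locale locally_convex_closed_map =
  fixes X :: "'a topology" and f :: "'a \<Rightarrow> 'v::real_normed_vector"
  assumes continuous: "continuous_map X euclidean f"
    and closed: "closed_map X euclidean f"
    and normal: "normal_space X"
    and charts: "x \<in> topspace X \<Longrightarrow> \<exists>U. chart X f U \<and> x \<in> U"
begin

abbreviation same :: "'a \<Rightarrow> 'a \<Rightarrow> bool" (infix "\<bowtie>" 50)
  where "u \<bowtie> w \<equiv> same_fiber_component X f u w"

lemmas same_refl = same_fiber_component_refl[of _ X f]
lemmas same_eq = same_fiber_component_eq[of X f]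
lemmas same_sym = same_fiber_component_sym[of X f]
lemmas same_trans = same_fiber_component_trans[of X f]
lemmas same_topspace = same_fiber_component_topspace[of X f]

text \<open>The union of the fiber components that meet \<open>U\<close>, a priori smaller than the
  preimage of the image of \<open>U\<close>.\<close>

definition saturation :: "'a set \<Rightarrow> 'a set" where
  "saturation U = {w. \<exists>u\<in>U. u \<bowtie> w}"

lemma image_saturation: "f ` saturation U \<subseteq> f ` U"
proof
  fix p assume "p \<in> f ` saturation U"
  then obtain u w where "u \<in> U" "u \<bowtie> w" "p = f w"
    by (auto simp: saturation_def)
  then show "p \<in> f ` U"
    using same_eq by (metis imageI)
qed

lemma openin_preimage: "openin X U \<Longrightarrow> open S \<Longrightarrow> openin X {x\<in>U. f x \<in> S}"
  using openin_continuous_map_preimage_gen[OF continuous] by auto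

lemma closedin_preimage: "closed S \<Longrightarrow> closedin X {x\<in>topspace X. f x \<in> S}"
  using closedin_continuous_map_preimage[OF continuous] by auto

text \<open>Openness spreads along a connected part \<open>T\<close> of a fiber: if a chart meets
  \<open>T\<close> in the interior of the saturation, all its points of \<open>T\<close> are
  interior. So the interior is relatively clopen in \<open>T\<close>.\<close>

lemma openin_saturation:
  assumes "openin X U"
  shows "openin X (saturation U)"
proof -
  define I where "I = X interior_of saturation U"
  have "U \<subseteq> saturation U"
    using openin_subset[OF assms] same_refl by (auto simp: saturation_def)
  then have "U \<subseteq> I"
    using assms by (simp add: I_def interior_of_maximal)
  have "y \<in> I" if x: "x \<in> U" and "x \<bowtie> y" for x y
  proof (rule ccontr)
    assume "y \<notin> I"
    obtain T where T: "connectedin X T" "x \<in> T" "y \<in> T" "\<And>z. z \<in> T \<Longrightarrow> f z = f x"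
      using \<open>x \<bowtie> y\<close> by (auto simp: same_fiber_component_def)
    define J where "J = \<Union>{W. chart X f W \<and> W \<inter> T \<inter> I = {}}"
    have "z \<in> I \<union> J" if z: "z \<in> T" for z
    proof -
      obtain W where W: "chart X f W" "z \<in> W"
        using charts T z connectedin_subset_topspace by blast
      show ?thesis
      proof (cases "W \<inter> T \<inter> I = {}")
        case True
        then show ?thesis
          using W by (auto simp: J_def)
      next
        case False
        then obtain w where w: "w \<in> W" "w \<in> T" "w \<in> I"
          by blast
        have "openin X (W \<inter> I)"
          using W by (simp add: chart_def I_def openin_Int)
        then have "openin (top_of_set (f ` W)) (f ` (W \<inter> I))"
          using W unfolding chart_def by blast
        then obtain S where S: "open S" "f ` (W \<inter> I) = f ` W \<inter> S"
          by (auto simp: openin_open)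
        \<comment> \<open>Values of \<open>f\<close> on \<open>G\<close> are also taken on
          \<open>W \<inter> I\<close>, and in a chart equal values mean equal fiber components;
          hence \<open>G\<close> stays in the saturation.\<close>
        define G where "G = {v \<in> W. f v \<in> S}"
        have "openin X G"
          unfolding G_def using W S by (simp add: openin_preimage chart_def)
        moreover have "z \<in> G"
        proof -
          have "f z = f w"
            using T z w by metis
          moreover have "f w \<in> S"
            using S w by blast
          ultimately show ?thesis
            using W by (simp add: G_def)
        qed
        moreover have "G \<subseteq> saturation U"
        proof
          fix v assume "v \<in> G"
          then have "v \<in> W" "f v \<in> f ` (W \<inter> I)"
            using S by (auto simp: G_def)
          then obtain v' where v': "v' \<in> W" "v' \<in> I" "f v' = f v"
            by auto
          then have "v' \<bowtie> v"
            using W(1) \<open>v \<in> W\<close> unfolding chart_def by blast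
          moreover have "v' \<in> saturation U"
            using v'(2) interior_of_subset[of X "saturation U"] unfolding I_def by blast
          ultimately show "v \<in> saturation U"
            using same_trans unfolding saturation_def by blast
        qed
        ultimately show ?thesis
          by (auto simp: I_def interior_of_def)
      qed
    qed
    moreover have "openin X I" "openin X J"
      by (auto simp: I_def J_def chart_def)
    moreover have "I \<inter> J \<inter> T = {}"
      by (auto simp: J_def)
    moreover have "I \<inter> T \<noteq> {}"
      using x \<open>U \<subseteq> I\<close> T by blast
    moreover have "J \<inter> T \<noteq> {}"
      using calculation(1) \<open>y \<notin> I\<close> T by blast
    ultimately show False
      using connectedinD[OF T(1), of I J] by blast
  qed
  then have "saturation U \<subseteq> I"
    by (auto simp: saturation_def)
  then have "I = saturation U"
    by (simp add: I_def interior_of_subset subset_antisym)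
  then show ?thesis
    using I_def by (metis openin_interior_of)
qed

text \<open>The extra closure condition prepares uniqueness of local sections: over each value in
  its image, a good set contains exactly one component of the fiber.\<close>

definition good :: "'a set \<Rightarrow> bool" where
  "good U \<longleftrightarrow> chart X f U \<and> (\<forall>u\<in>U. \<forall>w. u \<bowtie> w \<longrightarrow> w \<in> U)"

text \<open>The saturation of a chart is good. For openness, an open \<open>G\<close> in it is
  replaced by \<open>saturation G \<inter> U\<close>, which is open, lies in the chart and has the
  same image.\<close>

lemma good_exists:
  assumes "x \<in> topspace X"
  obtains U where "good U" "x \<in> U"
proof -
  obtain U where U: "chart X f U" "x \<in> U"
    using charts assms by blast
  let ?S = "saturation U"
  have sub: "U \<subseteq> topspace X"
    using U openin_subset by (auto simp: chart_def)
  have "U \<subseteq> ?S"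
    using sub by (auto simp: saturation_def intro: same_refl)
  moreover have eq: "f ` ?S = f ` U"
    using image_saturation \<open>U \<subseteq> ?S\<close> by blast
  moreover have "openin (top_of_set (f ` U)) (f ` G)" if G: "openin X G" "G \<subseteq> ?S" for G
  proof -
    have "openin X (saturation G \<inter> U)"
      using U G by (simp add: openin_saturation chart_def openin_Int)
    then have "openin (top_of_set (f ` U)) (f ` (saturation G \<inter> U))"
      using U by (simp add: chart_def)
    moreover have "f ` (saturation G \<inter> U) = f ` G"
    proof
      show "f ` (saturation G \<inter> U) \<subseteq> f ` G"
        using image_saturation by blast
      show "f ` G \<subseteq> f ` (saturation G \<inter> U)"
      proof
        fix p assume "p \<in> f ` G"
        then obtain y where y: "y \<in> G" "p = f y"
          by auto
        then obtain u where "u \<in> U" "u \<bowtie> y"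
          using G by (auto simp: saturation_def)
        then have "u \<in> saturation G" "f u = p"
          using y same_sym[of u y] same_eq[of u y]
          by (auto simp: saturation_def)
        then show "p \<in> f ` (saturation G \<inter> U)"
          using \<open>u \<in> U\<close> by blast
      qed
    qed
    ultimately show ?thesis
      by simp
  qed
  moreover have "u \<bowtie> w" if uw: "u \<in> ?S" "w \<in> ?S" "f u = f w" for u w
  proof -
    obtain u' w' where *: "u' \<in> U" "u' \<bowtie> u" "w' \<in> U" "w' \<bowtie> w"
      using uw by (auto simp: saturation_def)
    then have "f u' = f w'"
      using uw by (metis same_eq)
    then have "u' \<bowtie> w'"
      using * U by (simp add: chart_def)
    then show ?thesis
      using * by (meson same_sym same_trans)
  qed
  ultimately have "chart X f ?S"
    using U by (simp add: chart_def openin_saturation)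
  moreover have "w \<in> ?S" if "u \<in> ?S" "u \<bowtie> w" for u w
    using that same_trans[of _ u w] by (auto simp: saturation_def)
  ultimately have "good ?S"
    by (simp add: good_def)
  then show ?thesis
    using that \<open>U \<subseteq> ?S\<close> U by blast
qed

lemma good_openin: "good U \<Longrightarrow> openin X U"
  and good_convex: "good U \<Longrightarrow> convex (f ` U)"
  and good_open_image:
    "good U \<Longrightarrow> openin X G \<Longrightarrow> G \<subseteq> U \<Longrightarrow> openin (top_of_set (f ` U)) (f ` G)"
  unfolding good_def chart_def by blast+

lemma good_same: "good U \<Longrightarrow> u \<in> U \<Longrightarrow> w \<in> U \<Longrightarrow> f u = f w \<Longrightarrow> u \<bowtie> w"
  unfolding good_def chart_def by blast

lemma good_saturated: "good U \<Longrightarrow> u \<in> U \<Longrightarrow> u \<bowtie> w \<Longrightarrow> w \<in> U"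
  unfolding good_def by blast

lemma good_openin_image_Int:
  "good U \<Longrightarrow> good V \<Longrightarrow> openin (top_of_set (f ` U)) (f ` (U \<inter> V))"
  by (simp add: good_open_image good_openin openin_Int)

lemma good_topspace: "good U \<Longrightarrow> u \<in> U \<Longrightarrow> u \<in> topspace X"
  using good_openin openin_subset by blast

text \<open>The tube property of closed maps: \<open>E\<close> is the complement of the image of the
  closed set \<open>topspace X - O'\<close>.\<close>

lemma closed_fiberwise_nhd:
  assumes "openin X O'" "\<And>x. x \<in> topspace X \<Longrightarrow> f x \<in> S \<Longrightarrow> x \<in> O'"
  obtains E where "open E" "S \<subseteq> E" "\<And>x. x \<in> topspace X \<Longrightarrow> f x \<in> E \<Longrightarrow> x \<in> O'"
proof
  have "closedin X (topspace X - O')"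
    using assms by blast
  then show "open (- f ` (topspace X - O'))"
    using closed by (auto simp: closed_map_def)
  show "S \<subseteq> - f ` (topspace X - O')"
    using assms by blast
qed auto

text \<open>Separate the components of \<open>u\<close> and \<open>v\<close> inside the normal space \<open>X\<close>; since \<open>f\<close> is closed, all
nearby fibers stay within the two separating open sets.\<close>

lemma good_separation:
  assumes "good U" "good V" "u \<in> U" "v \<in> V" "f u = f v" "\<not> u \<bowtie> v"
  obtains G H where "openin X G" "openin X H" "G \<subseteq> U" "H \<subseteq> V" "u \<in> G" "v \<in> H"
    "\<And>x y. x \<in> G \<Longrightarrow> y \<in> H \<Longrightarrow> \<not> x \<bowtie> y"
proof -
  define F where "F = {x \<in> topspace X. f x = f u}"
  define K where "K = {x. u \<bowtie> x}"
  have K: "K \<subseteq> F"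
    using same_eq[of u] same_topspace[of u] by (auto simp: K_def F_def)
  have F: "closedin X F"
    using closedin_preimage[of "{f u}"] by (simp add: F_def)
  \<comment> \<open>A good set meets the fiber \<open>F\<close> in one component only, so
    \<open>K\<close> and \<open>F - K\<close> are both relatively open in \<open>F\<close>, hence
    both closed in \<open>X\<close>.\<close>
  have ex: "\<exists>W. openin X W \<and> x \<in> W \<and> (\<forall>y \<in> W \<inter> F. x \<bowtie> y)" if x: "x \<in> F" for x
  proof -
    obtain W where "good W" "x \<in> W"
      using good_exists x by (auto simp: F_def)
    then show ?thesis
      using good_openin good_same x by (metis (mono_tags, lifting) F_def Int_iff mem_Collect_eq)
  qed
  have "openin (subtopology X F) K"
  proof (subst openin_subopen, safe)
    fix x assume x: "x \<in> K"
    then obtain W where W: "openin X W" "x \<in> W" "\<forall>y \<in> W \<inter> F. x \<bowtie> y"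
      using ex K by blast
    then have "W \<inter> F \<subseteq> K"
      using x same_trans[of u x] by (auto simp: K_def)
    moreover have "openin (subtopology X F) (W \<inter> F)"
      using W by (auto simp: openin_subtopology)
    ultimately show "\<exists>T. openin (subtopology X F) T \<and> x \<in> T \<and> T \<subseteq> K"
      using W x K by blast
  qed
  moreover have "openin (subtopology X F) (F - K)"
  proof (subst openin_subopen, safe)
    fix x assume x: "x \<in> F" "x \<notin> K"
    then obtain W where W: "openin X W" "x \<in> W" "\<forall>y \<in> W \<inter> F. x \<bowtie> y"
      using ex by blast
    then have "W \<inter> F \<subseteq> F - K"
      using x same_trans[of u _ x] same_sym[of x] by (auto simp: K_def)
    moreover have "openin (subtopology X F) (W \<inter> F)"
      using W by (auto simp: openin_subtopology)
    ultimately show "\<exists>T. openin (subtopology X F) T \<and> x \<in> T \<and> T \<subseteq> F - K"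
      using W x by blast
  qed
  moreover have "topspace (subtopology X F) = F"
    by (rule topspace_subtopology_subset[OF closedin_subset[OF F]])
  ultimately have "closedin (subtopology X F) K" "closedin (subtopology X F) (F - K)"
    using K by (simp_all add: closedin_def double_diff)
  then have "closedin X K" "closedin X (F - K)"
    using closedin_trans_full[OF _ F] by simp_all
  then obtain O1 O2 where O: "openin X O1" "openin X O2" "K \<subseteq> O1" "F - K \<subseteq> O2" "O1 \<inter> O2 = {}"
    using normal unfolding normal_space_def disjnt_def by (metis Diff_disjoint)
  have "openin X (O1 \<union> O2)" "\<And>x. x \<in> topspace X \<Longrightarrow> f x \<in> {f u} \<Longrightarrow> x \<in> O1 \<union> O2"
    using O by (auto simp: F_def)
  then obtain E where E: "open E" "{f u} \<subseteq> E" "\<And>x. x \<in> topspace X \<Longrightarrow> f x \<in> E \<Longrightarrow> x \<in> O1 \<union> O2"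
    using closed_fiberwise_nhd by blast
  show ?thesis
  proof
    show "openin X {x \<in> U \<inter> O1. f x \<in> E}" "openin X {x \<in> V \<inter> O2. f x \<in> E}"
      by (intro openin_preimage openin_Int good_openin assms O E)+
    have "u \<in> K" "v \<in> F - K"
      using assms good_topspace by (auto simp: K_def F_def intro: same_refl)
    then show "u \<in> {x \<in> U \<inter> O1. f x \<in> E}" "v \<in> {x \<in> V \<inter> O2. f x \<in> E}"
      using assms O E by auto
  next
    fix x y assume xy: "x \<in> {x \<in> U \<inter> O1. f x \<in> E}" "y \<in> {x \<in> V \<inter> O2. f x \<in> E}"
    show "\<not> x \<bowtie> y"
    proof
      assume "x \<bowtie> y"
      then obtain T where T: "connectedin X T" "x \<in> T" "y \<in> T" "\<And>z. z \<in> T \<Longrightarrow> f z = f x"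
        by (auto simp: same_fiber_component_def)
      have "T \<subseteq> O1 \<union> O2"
      proof
        fix z assume "z \<in> T"
        then have "f z = f x" "z \<in> topspace X"
          using T connectedin_subset_topspace by blast+
        then show "z \<in> O1 \<union> O2"
          using E(3)[of z] xy by simp
      qed
      then show False
        using connectedinD[OF T(1) O(1,2)] O T xy by blast
    qed
  qed auto
qed

text \<open>Two local sections over convex sets that agree somewhere agree wherever both are defined.\<close>

lemma good_overlap:
  assumes "good U" "good V" "U \<inter> V \<noteq> {}" "w \<in> U" "f w \<in> f ` V"
  shows "w \<in> V"
proof -
  \<comment> \<open>The common values form a convex, hence connected set; the values
    \<open>D0\<close> taken at common points turn out to be clopen in it.\<close>
  define D where "D = f ` U \<inter> f ` V"
  have "connected D"
    unfolding D_def using assms by (simp add: convex_connected convex_Int good_convex)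
  define D0 where "D0 = f ` (U \<inter> V)"
  have "D0 \<subseteq> D"
    by (auto simp: D0_def D_def)
  have "openin (top_of_set (f ` U)) D0"
    unfolding D0_def using assms(1,2) by (rule good_openin_image_Int)
  then have o1: "openin (top_of_set D) D0"
    by (rule openin_subset_trans) (use \<open>D0 \<subseteq> D\<close> in \<open>auto simp: D_def\<close>)
  \<comment> \<open>At a value in \<open>D - D0\<close> the two sections pass through different
    components of the fiber, and separating these keeps the sections apart over all nearby
    values.\<close>
  have o2: "openin (top_of_set D) (D - D0)"
  proof (subst openin_subopen, safe)
    fix p assume p: "p \<in> D" "p \<notin> D0"
    then obtain u v where uv: "u \<in> U" "v \<in> V" "f u = p" "f v = p"
      by (auto simp: D_def)
    have "\<not> u \<bowtie> v"
    proof
      assume "u \<bowtie> v"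
      then have "v \<in> U"
        using good_saturated assms(1) uv(1) by blast
      then show False
        using uv p by (metis D0_def IntI imageI)
    qed
    then obtain G H where GH: "openin X G" "openin X H" "G \<subseteq> U" "H \<subseteq> V" "u \<in> G" "v \<in> H"
      "\<And>x y. x \<in> G \<Longrightarrow> y \<in> H \<Longrightarrow> \<not> x \<bowtie> y"
      using good_separation assms uv by (metis (no_types, lifting))
    have "openin (top_of_set (f ` U)) (f ` G)" "openin (top_of_set (f ` V)) (f ` H)"
      using GH assms good_open_image by blast+
    then obtain A B where "open A" "open B" "f ` G = f ` U \<inter> A" "f ` H = f ` V \<inter> B"
      by (auto simp: openin_open)
    then have "openin (top_of_set D) (f ` G \<inter> f ` H)"
      by (auto simp: D_def openin_open intro!: exI[of _ "A \<inter> B"])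
    moreover have "p \<in> f ` G \<inter> f ` H"
      using GH(5,6) uv by (metis IntI imageI)
    moreover have "f ` G \<inter> f ` H \<inter> D0 = {}"
    proof (intro equals0I)
      fix q assume "q \<in> f ` G \<inter> f ` H \<inter> D0"
      then obtain x y z where xyz: "x \<in> G" "q = f x" "y \<in> H" "q = f y" "z \<in> U" "z \<in> V" "q = f z"
        unfolding D0_def by (elim IntE imageE) (rule that)
      then have "x \<bowtie> z" "z \<bowtie> y"
        using GH assms good_same[of U x z] good_same[of V z y] by auto
      then show False
        using GH(7) xyz same_trans by blast
    qed
    moreover have "f ` G \<inter> f ` H \<subseteq> D"
      using GH by (auto simp: D_def)
    ultimately show "\<exists>T. openin (top_of_set D) T \<and> p \<in> T \<and> T \<subseteq> D - D0"
      by (intro exI[of _ "f ` G \<inter> f ` H"]) blast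
  qed
  have "closedin (top_of_set D) D0"
    using o2 \<open>D0 \<subseteq> D\<close> by (simp add: closedin_def)
  then have "D0 = D"
    using \<open>connected D\<close> o1 assms unfolding connected_clopen D0_def by blast
  then have "f w \<in> f ` (U \<inter> V)"
    using assms by (auto simp: D_def D0_def)
  then obtain z where "z \<in> U" "z \<in> V" "f w = f z"
    by auto
  then show ?thesis
    using assms good_same[of U z w] good_saturated[of V z w] by simp
qed

subsection \<open>Lifted segments\<close>

text \<open>\<open>lift v u w\<close> is a lift, as a finite chain through good sets, of the segment from \<open>f u\<close> to \<open>f w\<close>,
which has direction \<open>v\<close>. The degenerate steps \<open>s = 0\<close> let its points move within a fiber component.\<close>

definition step :: "'v \<Rightarrow> 'a \<Rightarrow> 'a \<Rightarrow> bool" where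
  "step v u w \<longleftrightarrow> (\<exists>U s. good U \<and> u \<in> U \<and> w \<in> U \<and> 0 \<le> s \<and> f w = f u + s *\<^sub>R v)"

abbreviation lift :: "'v \<Rightarrow> 'a \<Rightarrow> 'a \<Rightarrow> bool" where
  "lift v \<equiv> (step v)\<^sup>*\<^sup>*"

lemma stepI: "good U \<Longrightarrow> u \<in> U \<Longrightarrow> w \<in> U \<Longrightarrow> 0 \<le> s \<Longrightarrow> f w = f u + s *\<^sub>R v \<Longrightarrow> step v u w"
  by (auto simp: step_def)

lemma lift_image: "lift v u w \<Longrightarrow> \<exists>s\<ge>0. f w = f u + s *\<^sub>R v"
proof (induction rule: rtranclp_induct)
  case base
  show ?case
    by (auto intro: exI[of _ 0])
next
  case (step y z)
  then obtain s r where "s \<ge> 0" "r \<ge> 0" "f y = f u + s *\<^sub>R v" "f z = f y + r *\<^sub>R v"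
    by (auto simp: step_def)
  then show ?case
    by (intro exI[of _ "s + r"]) (simp add: algebra_simps)
qed

lemma lift_scale:
  assumes "lift v u w" "\<kappa> > 0"
  shows "lift (\<kappa> *\<^sub>R v) u w"
proof -
  have "step (\<kappa> *\<^sub>R v) x y" if xy: "step v x y" for x y
  proof -
    obtain U s where "good U" "x \<in> U" "y \<in> U" "0 \<le> s" "f y = f x + s *\<^sub>R v"
      using xy by (auto simp: step_def)
    then show ?thesis
      using assms by (intro stepI[of U _ _ "s / \<kappa>"]) auto
  qed
  then show ?thesis
    using assms(1) by (metis mono_rtranclp)
qed

text \<open>Step lengths are nonnegative, so a lift can return to its initial value only if
  \<open>v = 0\<close> or all lengths vanish. Then every step stays in one fiber component.\<close>

lemma lift_same:
  assumes "lift v u w" "f w = f u" "u \<in> topspace X"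
  shows "u \<bowtie> w"
  using assms
proof (induction rule: rtranclp_induct)
  case base
  then show ?case
    by (simp add: same_refl)
next
  case (step y z)
  obtain U s where U: "good U" "y \<in> U" "z \<in> U" "0 \<le> s" "f z = f y + s *\<^sub>R v"
    using step by (auto simp: step_def)
  obtain r where r: "r \<ge> 0" "f y = f u + r *\<^sub>R v"
    using lift_image[OF step.hyps(1)] by blast
  have "(r + s) *\<^sub>R v = 0"
    using r U step.prems by (simp add: algebra_simps)
  then have "v = 0 \<or> r = 0 \<and> s = 0"
    using r U by auto
  then have "f y = f u" "f z = f y"
    using r U by auto
  then show ?case
    using step U good_same by (metis same_trans)
qed

text \<open>Cuts a lift back to an earlier point \<open>w\<close> near its end. If the last step has
  length at least \<open>s\<close>, uniqueness of sections puts \<open>w\<close> into the good set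
  of that step; otherwise it puts the previous point \<open>y\<close> into \<open>U\<close>, and
  induction applies with excess \<open>s - t\<close>.\<close>

lemma lift_backtrack:
  assumes "lift v x u" "x \<in> topspace X" "good U" "u \<in> U" "w \<in> U" "f u = f w + s *\<^sub>R v" "0 \<le> s"
    "f w = f x + r *\<^sub>R v" "0 \<le> r"
  shows "lift v x w"
  using assms
proof (induction arbitrary: U s rule: rtranclp_induct)
  case base
  have "(r + s) *\<^sub>R v = 0"
    using base by (simp add: algebra_simps)
  then have "v = 0 \<or> r = 0"
    using base by auto
  then have "f w = f x + 0 *\<^sub>R v"
    using base by auto
  then have "step v x w"
    by (rule stepI[OF base(2-4) order_refl])
  then show ?case
    by simp
next
  case (step y z)
  obtain V t where V: "good V" "y \<in> V" "z \<in> V" "0 \<le> t" "f z = f y + t *\<^sub>R v"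
    using step.hyps by (auto simp: step_def)
  have fw: "f w = f y + (t - s) *\<^sub>R v" and fy: "f y = f w + (s - t) *\<^sub>R v"
    using V step.prems by (simp_all add: algebra_simps)
  show ?case
  proof (cases "s \<le> t")
    case True
    have "f y \<in> f ` V" "f y + t *\<^sub>R v \<in> f ` V"
      using V(2,3) by (simp_all flip: V(5))
    then have "f y + (t - s) *\<^sub>R v \<in> f ` V"
      by (rule convex_add_scaleR[OF good_convex[OF V(1)]]) (use step.prems(6) True in simp_all)
    then have "f w \<in> f ` V"
      using fw by simp
    moreover have "U \<inter> V \<noteq> {}"
      using step.prems(3) V(3) by blast
    ultimately have "w \<in> V"
      using good_overlap[OF step.prems(2) V(1) _ step.prems(4)] by blast
    then have "step v y w"
      using V(1,2) True fw by (intro stepI[of V _ _ "t - s"]) auto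
    then show ?thesis
      using step.hyps by simp
  next
    case False
    have "f w \<in> f ` U" "f w + s *\<^sub>R v \<in> f ` U"
      using step.prems(3,4) by (simp_all flip: step.prems(5))
    then have "f w + (s - t) *\<^sub>R v \<in> f ` U"
      by (rule convex_add_scaleR[OF good_convex[OF step.prems(2)]]) (use V(4) False in simp_all)
    then have "f y \<in> f ` U"
      using fy by simp
    moreover have "V \<inter> U \<noteq> {}"
      using step.prems(3) V(3) by blast
    ultimately have "y \<in> U"
      using good_overlap[OF V(1) step.prems(2) _ V(2)] by blast
    moreover have "0 \<le> s - t"
      using False by simp
    ultimately show ?thesis
      using step.IH[OF step.prems(1,2) _ step.prems(4) fy _ step.prems(7,8)] by blast
  qed
qed

section \<open>Linked points and quasi-components over segments\<close>

definition over :: "'v set \<Rightarrow> 'a set" where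
  "over S = {x \<in> topspace X. f x \<in> S}"

text \<open>Quasi-components instead of components: a separation of the preimage of a segment persists for
all nearby segments, so this relation is closed.\<close>

definition linked :: "'a \<Rightarrow> 'a \<Rightarrow> bool" where
  "linked x y \<longleftrightarrow> quasi_component_of (subtopology X (over (closed_segment (f x) (f y)))) x y"

lemma topspace_over: "topspace X \<inter> over S = over S"
  by (auto simp: over_def)

lemma linked_sym: "linked x y \<Longrightarrow> linked y x"
  by (metis linked_def quasi_component_of_sym closed_segment_commute)

lemma linked_topspace: "linked x y \<Longrightarrow> x \<in> topspace X \<and> y \<in> topspace X"
  by (auto simp: linked_def quasi_component_of_def over_def topspace_subtopology)

text \<open>A clopen \<open>T\<close> cannot split \<open>U\<close> over \<open>S\<close>: the
  images of the two parts would be relatively open in the convex set \<open>D\<close>, and disjoint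
  because points of \<open>U\<close> with equal values are joined by a connected set inside
  \<open>over S\<close>.\<close>

lemma good_clopen_over:
  assumes "good U" "convex S"
    and T: "openin (subtopology X (over S)) T" "closedin (subtopology X (over S)) T"
    and uw: "u \<in> U" "w \<in> U" "f u \<in> S" "f w \<in> S" "u \<in> T"
  shows "w \<in> T"
proof (rule ccontr)
  assume "w \<notin> T"
  define D where "D = f ` U \<inter> S"
  have "connected D"
    unfolding D_def using assms by (simp add: convex_connected convex_Int good_convex)
  have T': "openin (subtopology X (over S)) (over S - T)"
    using T by (simp add: closedin_def topspace_over)
  have *: "openin (top_of_set D) (f ` (U \<inter> Q))" if Q: "openin (subtopology X (over S)) Q" for Q
  proof -
    obtain G where G: "openin X G" "Q = G \<inter> over S"
      using Q by (auto simp: openin_subtopology)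
    have "openin (top_of_set (f ` U)) (f ` (U \<inter> G))"
      using assms(1) G(1) by (intro good_open_image) (auto simp: good_openin openin_Int)
    then obtain B where "open B" "f ` (U \<inter> G) = f ` U \<inter> B"
      by (auto simp: openin_open)
    moreover have "f ` (U \<inter> Q) = f ` (U \<inter> G) \<inter> S"
      using G good_topspace[OF assms(1)] by (auto simp: over_def)
    ultimately have "open B \<and> f ` (U \<inter> Q) = D \<inter> B"
      by (simp add: D_def Int_ac)
    then show ?thesis
      unfolding openin_open by blast
  qed
  have "f ` (U \<inter> T) \<inter> f ` (U \<inter> (over S - T)) = {}"
  proof (intro equals0I)
    fix q assume "q \<in> f ` (U \<inter> T) \<inter> f ` (U \<inter> (over S - T))"
    then have "q \<in> f ` (U \<inter> T)" and "q \<in> f ` (U \<inter> (over S - T))"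
      unfolding Int_iff[of q] by fast+
    then obtain z z' where "z \<in> U \<inter> T" "q = f z" "z' \<in> U \<inter> (over S - T)" "q = f z'"
      by (elim imageE) (rule that)
    then have z: "z \<in> U" "z \<in> T" "z' \<in> U" "z' \<in> over S - T" "f z = f z'"
      by auto
    obtain C where C: "connectedin X C" "z \<in> C" "z' \<in> C" "\<And>c. c \<in> C \<Longrightarrow> f c = f z"
      using good_same[OF assms(1) z(1,3,5)] unfolding same_fiber_component_def by blast
    have "C \<subseteq> over S"
    proof
      fix c assume "c \<in> C"
      then have "f c = f z" "c \<in> topspace X"
        using C connectedin_subset_topspace by blast+
      then show "c \<in> over S"
        using z by (simp add: over_def)
    qed
    then have "connectedin (subtopology X (over S)) C"
      using C by (simp add: connectedin_subtopology)
    from connectedinD[OF this T(1) T'] show False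
      using C z \<open>C \<subseteq> over S\<close> by blast
  qed
  moreover have "D \<subseteq> f ` (U \<inter> T) \<union> f ` (U \<inter> (over S - T))"
    using good_topspace[OF assms(1)] by (auto simp: D_def over_def)
  moreover have "f u \<in> f ` (U \<inter> T)" "f w \<in> f ` (U \<inter> (over S - T))"
    using uw \<open>w \<notin> T\<close> good_topspace[OF assms(1)] by (auto simp: over_def)
  ultimately have "\<not> connected D"
    using *[OF T(1)] *[OF T'] unfolding connected_openin by (metis empty_iff)
  then show False
    using \<open>connected D\<close> by simp
qed

lemma lift_imp_linked:
  assumes "lift v x u" "x \<in> topspace X"
  shows "linked x u"
proof -
  \<comment> \<open>The claim concerns every convex \<open>S\<close> containing both end values,
    since the segment itself grows with each step; such an \<open>S\<close> also contains the
    intermediate values.\<close>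
  have "u \<in> topspace X \<and> (\<forall>S T. convex S \<and> f x \<in> S \<and> f u \<in> S \<and> openin (subtopology X (over S)) T
      \<and> closedin (subtopology X (over S)) T \<longrightarrow> (x \<in> T \<longleftrightarrow> u \<in> T))"
    using assms
  proof (induction rule: rtranclp_induct)
    case (step y z)
    obtain V t where V: "good V" "y \<in> V" "z \<in> V" "0 \<le> t" "f z = f y + t *\<^sub>R v"
      using step.hyps by (auto simp: step_def)
    obtain r where r: "r \<ge> 0" "f y = f x + r *\<^sub>R v"
      using lift_image[OF step.hyps(1)] by blast
    have "x \<in> T \<longleftrightarrow> z \<in> T" if S: "convex S" "f x \<in> S" "f z \<in> S"
        "openin (subtopology X (over S)) T" "closedin (subtopology X (over S)) T" for S T
    proof -
      have "f z = f x + (r + t) *\<^sub>R v"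
        using V r by (simp add: algebra_simps)
      then have "f x + (r + t) *\<^sub>R v \<in> S"
        using S(3) by simp
      then have "f x + r *\<^sub>R v \<in> S"
        by (rule convex_add_scaleR[OF S(1,2)]) (use V(4) r(1) in simp_all)
      then have "f y \<in> S"
        using r(2) by simp
      then have "x \<in> T \<longleftrightarrow> y \<in> T"
        using step.IH step.prems S by blast
      then show ?thesis
        using good_clopen_over[OF V(1) S(1,4,5)] V(2,3) \<open>f y \<in> S\<close> S(3) by blast
    qed
    then show ?case
      using V good_topspace by blast
  qed auto
  then show ?thesis
    using assms by (auto simp: linked_def quasi_component_of_def over_def)
qed

text \<open>The points over the segment that a lift from \<open>x\<close> reaches form a clopen set:
  inside a good set one moves forward by a step and backward by
  \<open>lift_backtrack\<close>.\<close>

lemma linked_imp_lift: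
  assumes "linked x y"
  shows "lift (f y - f x) x y"
proof -
  define v where "v = f y - f x"
  define F where "F = over (closed_segment (f x) (f y))"
  define M where "M = {u \<in> F. lift v x u}"
  have x: "x \<in> topspace X" "y \<in> topspace X"
    using assms linked_topspace by auto
  have F: "\<exists>r\<ge>0. f u = f x + r *\<^sub>R v" if u: "u \<in> F" for u
    using u by (auto simp: F_def over_def closed_segment_def v_def algebra_simps)
  have M: "w \<in> M" if U: "good U" "u \<in> U" "w \<in> U" "u \<in> M" "w \<in> F" for U u w
  proof -
    have "lift v x u" "u \<in> F"
      using U by (auto simp: M_def)
    obtain r s where r: "r \<ge> 0" "f u = f x + r *\<^sub>R v" and s: "s \<ge> 0" "f w = f x + s *\<^sub>R v"
      using F \<open>u \<in> F\<close> U by blast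
    have "lift v x w"
    proof (cases "r \<le> s")
      case True
      then have "step v u w"
        using U r s by (intro stepI[of U _ _ "s - r"]) (auto simp: algebra_simps)
      then show ?thesis
        using \<open>lift v x u\<close> by simp
    next
      case False
      show ?thesis
        by (rule lift_backtrack[OF \<open>lift v x u\<close> x(1) U(1-3), of "r - s" s])
          (use r s False in \<open>auto simp: algebra_simps\<close>)
    qed
    then show ?thesis
      using U by (simp add: M_def)
  qed
  have W: "\<exists>W. openin (subtopology X F) (W \<inter> F) \<and> u \<in> W \<and> good W" if u: "u \<in> F" for u
  proof -
    obtain W where "good W" "u \<in> W"
      using good_exists u by (auto simp: F_def over_def)
    then show ?thesis
      using good_openin by (auto simp: openin_subtopology)
  qed
  have "openin (subtopology X F) M"
  proof (subst openin_subopen, safe)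
    fix u assume u: "u \<in> M"
    then have "u \<in> F"
      by (simp add: M_def)
    then obtain W where "openin (subtopology X F) (W \<inter> F)" "u \<in> W" "good W"
      using W by blast
    then show "\<exists>T. openin (subtopology X F) T \<and> u \<in> T \<and> T \<subseteq> M"
      using M u \<open>u \<in> F\<close> by (intro exI[of _ "W \<inter> F"]) blast
  qed
  moreover have "openin (subtopology X F) (F - M)"
  proof (subst openin_subopen, safe)
    fix u assume u: "u \<in> F" "u \<notin> M"
    then obtain W where "openin (subtopology X F) (W \<inter> F)" "u \<in> W" "good W"
      using W by blast
    then show "\<exists>T. openin (subtopology X F) T \<and> u \<in> T \<and> T \<subseteq> F - M"
      using M u by (intro exI[of _ "W \<inter> F"]) blast
  qed
  moreover have "M \<subseteq> F"
    by (auto simp: M_def)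
  ultimately have "openin (subtopology X F) M" "closedin (subtopology X F) M"
    by (simp_all add: closedin_def F_def topspace_over)
  moreover have "x \<in> M"
    using x by (auto simp: M_def F_def over_def)
  ultimately have "y \<in> M"
    using assms unfolding linked_def quasi_component_of_def F_def by blast
  then show ?thesis
    by (simp add: M_def v_def)
qed

lemma linked_same:
  assumes "linked x y" "f x = f y"
  shows "x \<bowtie> y"
  using lift_same[OF linked_imp_lift[OF assms(1)]] assms linked_topspace by metis

text \<open>Normality thickens a clopen separation of \<open>a\<close> from \<open>y\<close> to
  disjoint open sets, which by closedness of \<open>f\<close> cover the preimage of a neighborhood
  of the segment. For \<open>z\<close> near \<open>y\<close> the segment from \<open>f a\<close> to
  \<open>f z\<close> stays in that neighborhood.\<close>

lemma closedin_linked: "closedin X {y. linked a y}"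
proof -
  have "openin X (topspace X - {y. linked a y})"
  proof (subst openin_subopen, intro ballI)
    fix y assume "y \<in> topspace X - {y. linked a y}"
    then have y: "y \<in> topspace X" "\<not> linked a y"
      by auto
    show "\<exists>T. openin X T \<and> y \<in> T \<and> T \<subseteq> topspace X - {y. linked a y}"
    proof (cases "a \<in> topspace X")
      case False
      then show ?thesis
        using linked_topspace y by (intro exI[of _ "topspace X"]) auto
    next
      case True
      define F where "F = over (closed_segment (f a) (f y))"
      have "closed (closed_segment (f a) (f y))"
        by (simp add: compact_imp_closed)
      then have F: "closedin X F"
        using closedin_preimage by (auto simp: F_def over_def)
      have ay: "a \<in> F" "y \<in> F"
        using True y by (auto simp: F_def over_def)
      have "\<exists>T. closedin (subtopology X F) T \<and> openin (subtopology X F) T \<and> a \<in> T \<and> y \<notin> T"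
      proof -
        obtain T where T: "closedin (subtopology X F) T" "openin (subtopology X F) T"
          "(a \<in> T) \<noteq> (y \<in> T)"
          using y ay unfolding linked_def quasi_component_of_def F_def topspace_subtopology topspace_over by blast
        then have "closedin (subtopology X F) (F - T)" "openin (subtopology X F) (F - T)"
          using closedin_diff[OF closedin_topspace T(2)] openin_diff[OF openin_topspace T(1)]
          by (simp_all add: F_def topspace_over)
        then show ?thesis
          using T ay by blast
      qed
      then obtain T where T: "closedin (subtopology X F) T" "openin (subtopology X F) T" "a \<in> T" "y \<notin> T"
        by blast
      then have "closedin (subtopology X F) (F - T)"
        using closedin_diff[OF closedin_topspace T(2)] by (simp add: F_def topspace_over)
      then have "closedin X T" "closedin X (F - T)"
        using T closedin_trans_full[OF _ F] by simp_all
      then obtain O1 O2 where O: "openin X O1" "openin X O2" "T \<subseteq> O1" "F - T \<subseteq> O2" "O1 \<inter> O2 = {}"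
        using normal unfolding normal_space_def disjnt_def by (metis Diff_disjoint)
      have "openin X (O1 \<union> O2)"
        "\<And>x. x \<in> topspace X \<Longrightarrow> f x \<in> closed_segment (f a) (f y) \<Longrightarrow> x \<in> O1 \<union> O2"
        using O by (auto simp: F_def over_def)
      then obtain E where E: "open E" "closed_segment (f a) (f y) \<subseteq> E"
          "\<And>x. x \<in> topspace X \<Longrightarrow> f x \<in> E \<Longrightarrow> x \<in> O1 \<union> O2"
        using closed_fiberwise_nhd by blast
      obtain e where e: "e > 0" "(\<Union>p\<in>closed_segment (f a) (f y). ball p e) \<subseteq> E"
        using compact_subset_open_imp_ball_epsilon_subset[OF compact_segment E(1,2)] by metis
      define N where "N = {z \<in> O2. f z \<in> ball (f y) e}"
      have "openin X N"
        unfolding N_def by (intro openin_preimage O open_ball)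
      moreover have "y \<in> N"
        using O ay T e by (auto simp: N_def)
      moreover have "\<not> linked a z" if z: "z \<in> N" for z
      proof
        assume "linked a z"
        define F' where "F' = over (closed_segment (f a) (f z))"
        have "closed_segment (f a) (f z) \<subseteq> E"
        proof
          fix q assume "q \<in> closed_segment (f a) (f z)"
          then obtain t where t: "0 \<le> t" "t \<le> 1" "q = (1 - t) *\<^sub>R f a + t *\<^sub>R f z"
            by (auto simp: closed_segment_def)
          \<comment> \<open>The point of the original segment with the same parameter as
            \<open>q\<close>; the two differ by \<open>t\<close> times
            \<open>f y - f z\<close>.\<close>
          define p where "p = (1 - t) *\<^sub>R f a + t *\<^sub>R f y"
          have "p \<in> closed_segment (f a) (f y)"
            using t by (auto simp: p_def closed_segment_def)
          moreover have "dist p q \<le> dist (f y) (f z)"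
          proof -
            have "p - q = t *\<^sub>R (f y - f z)"
              by (simp add: p_def t algebra_simps)
            then show ?thesis
              using t by (simp add: dist_norm mult_left_le_one_le)
          qed
          then have "q \<in> ball p e"
            using z by (simp add: N_def)
          ultimately show "q \<in> E"
            using e by blast
        qed
        then have F': "F' \<subseteq> O1 \<union> O2"
          using E by (auto simp: F'_def over_def)
        have "openin (subtopology X F') (F' \<inter> O1)" "openin (subtopology X F') (F' \<inter> O2)"
          using O by (auto simp: openin_subtopology)
        moreover have "F' - F' \<inter> O1 = F' \<inter> O2"
          using F' O by blast
        ultimately have "openin (subtopology X F') (F' \<inter> O1)" "closedin (subtopology X F') (F' \<inter> O1)"
          by (auto simp: closedin_def F'_def topspace_over)
        moreover have "a \<in> F' \<inter> O1" "z \<notin> F' \<inter> O1"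
          using True T O z by (auto simp: F'_def over_def N_def)
        ultimately show False
          using \<open>linked a z\<close> unfolding linked_def quasi_component_of_def F'_def by blast
      qed
      moreover have "N \<subseteq> topspace X"
        using \<open>openin X N\<close> openin_subset by blast
      ultimately show ?thesis
        by blast
    qed
  qed
  then show ?thesis
    using linked_topspace by (auto simp: closedin_def)
qed

section \<open>Tilting lifted segments\<close>

lemma lift_continues:
  assumes "lift e w a" "f a \<noteq> f w"
  obtains W \<delta> where "good W" "w \<in> W" "\<delta> > 0" "f w + \<delta> *\<^sub>R e \<in> f ` W"
proof -
  \<comment> \<open>Zero steps stay in one fiber component, which a good set contains as a whole;
    the first step of nonzero length provides \<open>W\<close>.\<close>
  have "f a \<noteq> f w \<longrightarrow> (\<exists>W \<delta>. good W \<and> w \<in> W \<and> \<delta> > 0 \<and> f w + \<delta> *\<^sub>R e \<in> f ` W)"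
    using assms(1)
  proof (induction rule: converse_rtranclp_induct)
    case (step y z)
    obtain V t where V: "good V" "y \<in> V" "z \<in> V" "0 \<le> t" "f z = f y + t *\<^sub>R e"
      using step.hyps by (auto simp: step_def)
    show ?case
    proof (cases "t = 0")
      case False
      then show ?thesis
        using V by (metis imageI less_eq_real_def)
    next
      case True
      then have "f z = f y"
        using V by simp
      then have "z \<bowtie> y"
        using V good_same by metis
      then show ?thesis
        using step.IH \<open>f z = f y\<close> good_saturated by metis
    qed
  qed auto
  then show ?thesis
    using assms that by blast
qed

text \<open>A lifted segment ending in \<open>a\<close> may be tilted at its other end \<open>u\<close> in any direction \<open>h\<close>
available in the local convex image. The direction \<open>h\<close> is carried along the segment: if it is
available at \<open>u\<close>, and the segment continues beyond the next point \<open>w\<close> of the same good set, then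
by convexity it is available at \<open>w\<close>, with a smaller length.\<close>

lemma lift_tilt:
  assumes "lift e u a" "good U" "u \<in> U" "f u + h \<in> f ` U"
  shows "\<exists>\<epsilon>>0. \<epsilon> \<le> 1 \<and> (\<forall>\<theta>. 0 \<le> \<theta> \<and> \<theta> \<le> \<epsilon> \<longrightarrow>
      (\<exists>u'\<in>U. f u' = f u + \<theta> *\<^sub>R h \<and> lift (f a - f u') u' a))"
  using assms
proof (induction arbitrary: U h rule: converse_rtranclp_induct)
  case base
  have "\<exists>u'\<in>U. f u' = f a + \<theta> *\<^sub>R h \<and> lift (f a - f u') u' a" if \<theta>: "0 \<le> \<theta>" "\<theta> \<le> 1" for \<theta>
  proof -
    have "f a + \<theta> *\<^sub>R h \<in> f ` U"
      using convex_add_scaleR[of "f ` U" "f a" 1 h \<theta>] base good_convex[of U] \<theta> by auto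
    then obtain u' where u': "u' \<in> U" "f u' = f a + \<theta> *\<^sub>R h"
      by auto
    then have "step (f a - f u') u' a"
      using base by (intro stepI[of U _ _ 1]) auto
    then show ?thesis
      using u' by auto
  qed
  then show ?case
    by (intro exI[of _ 1]) auto
next
  case (step u w)
  obtain V s where V: "good V" "u \<in> V" "w \<in> V" "0 \<le> s" "f w = f u + s *\<^sub>R e"
    using step.hyps by (auto simp: step_def)
  have UV: "openin (top_of_set (f ` U)) (f ` (U \<inter> V))" "f u \<in> f ` (U \<inter> V)"
    using good_openin_image_Int[OF step.prems(1) V(1)] step.prems(2) V(2) by auto
  obtain \<epsilon>1 where \<epsilon>1: "0 < \<epsilon>1" "\<epsilon>1 \<le> 1"
      "\<And>\<theta>. 0 \<le> \<theta> \<Longrightarrow> \<theta> \<le> \<epsilon>1 \<Longrightarrow> f u + \<theta> *\<^sub>R h \<in> f ` (U \<inter> V)"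
    using openin_segment_initial[OF UV(1) good_convex[OF step.prems(1)] UV(2) step.prems(3)] by blast
  show ?case
  proof (cases "f a = f w")
    case True
    \<comment> \<open>The rest of the lift stays in the fiber component of \<open>w\<close>, so
      \<open>a\<close> already lies in \<open>V\<close> and a single step from \<open>u'\<close>
      reaches it.\<close>
    have "w \<bowtie> a"
      by (rule lift_same[OF step.hyps(2) True good_topspace[OF V(1,3)]])
    then have "a \<in> V"
      using V good_saturated by blast
    have "\<exists>u'\<in>U. f u' = f u + \<theta> *\<^sub>R h \<and> lift (f a - f u') u' a" if \<theta>: "0 \<le> \<theta>" "\<theta> \<le> \<epsilon>1" for \<theta>
    proof -
      obtain u' where u': "u' \<in> U" "u' \<in> V" "f u' = f u + \<theta> *\<^sub>R h"
        using \<epsilon>1(3)[OF \<theta>] by auto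
      then have "step (f a - f u') u' a"
        using \<open>a \<in> V\<close> V by (intro stepI[of V _ _ 1]) auto
      then show ?thesis
        using u' by auto
    qed
    then show ?thesis
      using \<epsilon>1 by blast
  next
    case False
    obtain \<rho> where \<rho>: "\<rho> \<ge> 0" "f a = f w + \<rho> *\<^sub>R e"
      using lift_image[OF step.hyps(2)] by blast
    then have "\<rho> > 0"
      using False by (cases "\<rho> = 0") auto
    obtain W \<delta>0 where W: "good W" "w \<in> W" "\<delta>0 > 0" "f w + \<delta>0 *\<^sub>R e \<in> f ` W"
      using lift_continues[OF step.hyps(2) False] by blast
    have WV: "openin (top_of_set (f ` W)) (f ` (W \<inter> V))" "f w \<in> f ` (W \<inter> V)"
      using good_openin_image_Int[OF W(1) V(1)] W(2) V(3) by auto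
    \<comment> \<open>The continuation beyond \<open>w\<close> is known in \<open>W\<close>;
      shortening it brings it into the image of \<open>V\<close>, where it can be combined with the
      tilt at \<open>u\<close>.\<close>
    obtain \<eta> where \<eta>0: "0 < \<eta>"
      "\<And>\<theta>. 0 \<le> \<theta> \<Longrightarrow> \<theta> \<le> \<eta> \<Longrightarrow> f w + \<theta> *\<^sub>R (\<delta>0 *\<^sub>R e) \<in> f ` (W \<inter> V)"
      using openin_segment_initial[OF WV(1) good_convex[OF W(1)] WV(2) W(4)] by blast
    have \<eta>: "0 < \<eta>" "f w + \<eta> *\<^sub>R (\<delta>0 *\<^sub>R e) \<in> f ` (W \<inter> V)"
      using \<eta>0(1) \<eta>0(2)[of \<eta>] by simp_all
    define \<delta> where "\<delta> = \<eta> * \<delta>0"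
    have \<delta>: "\<delta> > 0" "f w + \<delta> *\<^sub>R e \<in> f ` V"
      using \<eta> W by (auto simp: \<delta>_def)
    \<comment> \<open>The weight for which the \<open>e\<close> parts cancel: the combination of the
      point \<open>\<delta>\<close> beyond \<open>f w\<close> and the tilted point at
      \<open>f u\<close> is \<open>f w\<close> shifted in direction \<open>h\<close> only.\<close>
    define \<mu> where "\<mu> = \<delta> / (s + \<delta>)"
    have \<mu>: "0 < \<mu>" "\<mu> \<le> 1" "(1 - \<mu>) * \<delta> = \<mu> * s"
      using \<delta> V by (auto simp: \<mu>_def field_simps)
    have "f u + \<epsilon>1 *\<^sub>R h \<in> f ` V"
      using \<epsilon>1(1) \<epsilon>1(3)[of \<epsilon>1] by auto
    then have "(1 - \<mu>) *\<^sub>R (f w + \<delta> *\<^sub>R e) + \<mu> *\<^sub>R (f u + \<epsilon>1 *\<^sub>R h) \<in> f ` V"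
      using convexD_alt[OF good_convex[OF V(1)] \<delta>(2)] \<mu> by simp
    moreover have "(1 - \<mu>) *\<^sub>R (f w + \<delta> *\<^sub>R e) + \<mu> *\<^sub>R (f u + \<epsilon>1 *\<^sub>R h)
        = f w + ((1 - \<mu>) * \<delta> - \<mu> * s) *\<^sub>R e + (\<mu> * \<epsilon>1) *\<^sub>R h"
      by (simp add: V algebra_simps)
    ultimately have "f w + (\<mu> * \<epsilon>1) *\<^sub>R h \<in> f ` V"
      using \<mu> by simp
    then obtain \<epsilon>2 where \<epsilon>2: "0 < \<epsilon>2" "\<epsilon>2 \<le> 1"
      "\<And>\<theta>. 0 \<le> \<theta> \<Longrightarrow> \<theta> \<le> \<epsilon>2 \<Longrightarrow>
        \<exists>w'\<in>V. f w' = f w + \<theta> *\<^sub>R (\<mu> * \<epsilon>1) *\<^sub>R h \<and> lift (f a - f w') w' a"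
      using step.IH[OF V(1,3)] by blast
    \<comment> \<open>The induction hypothesis measures tilts at \<open>w\<close> in units of
      \<open>(\<mu> * \<epsilon>1) *\<^sub>R h\<close>, hence the factor.\<close>
    define \<epsilon> where "\<epsilon> = min \<epsilon>1 (\<epsilon>2 * (\<mu> * \<epsilon>1))"
    have "\<exists>u'\<in>U. f u' = f u + \<theta> *\<^sub>R h \<and> lift (f a - f u') u' a" if \<theta>: "0 \<le> \<theta>" "\<theta> \<le> \<epsilon>" for \<theta>
    proof -
      obtain u' where u': "u' \<in> U" "u' \<in> V" "f u' = f u + \<theta> *\<^sub>R h"
        using \<epsilon>1(3)[of \<theta>] \<theta> by (auto simp: \<epsilon>_def)
      \<comment> \<open>Similar triangles: the segment from \<open>f u'\<close> to
        \<open>f a\<close> passes \<open>f w\<close> at offset \<open>\<kappa> * \<theta>\<close> in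
        direction \<open>h\<close>, so \<open>w'\<close> must be the lift tilted by that
        amount.\<close>
      define \<kappa> where "\<kappa> = \<rho> / (s + \<rho>)"
      have \<kappa>: "0 < \<kappa>" "\<kappa> \<le> 1" "\<kappa> * (s + \<rho>) = \<rho>"
        using \<open>\<rho> > 0\<close> V by (auto simp: \<kappa>_def)
      have pos: "0 < \<mu> * \<epsilon>1"
        using \<mu> \<epsilon>1 by simp
      have "\<kappa> * \<theta> \<le> \<theta>"
        using \<kappa> \<theta> by (simp add: mult_left_le_one_le)
      then have "\<kappa> * \<theta> / (\<mu> * \<epsilon>1) \<le> \<epsilon>2"
        using \<theta> pos by (simp add: \<epsilon>_def pos_divide_le_eq)
      moreover have "0 \<le> \<kappa> * \<theta> / (\<mu> * \<epsilon>1)"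
        using \<kappa> \<theta> pos by simp
      ultimately obtain w' where w': "w' \<in> V" "lift (f a - f w') w' a"
          "f w' = f w + (\<kappa> * \<theta> / (\<mu> * \<epsilon>1)) *\<^sub>R (\<mu> * \<epsilon>1) *\<^sub>R h"
        using \<epsilon>2(3) by blast
      have "f w' = f w + (\<kappa> * \<theta>) *\<^sub>R h"
        using w'(3) \<mu>(1) \<epsilon>1(1) by simp
      moreover have "f a - f u' = (s + \<rho>) *\<^sub>R e - \<theta> *\<^sub>R h"
        by (simp add: u' \<rho> V algebra_simps)
      then have "\<kappa> *\<^sub>R (f a - f u') = (\<kappa> * (s + \<rho>)) *\<^sub>R e - (\<kappa> * \<theta>) *\<^sub>R h"
        by (simp add: scaleR_diff_right)
      then have "\<kappa> *\<^sub>R (f a - f u') = \<rho> *\<^sub>R e - (\<kappa> * \<theta>) *\<^sub>R h"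
        using \<kappa> by simp
      ultimately have eq: "f a - f w' = \<kappa> *\<^sub>R (f a - f u')"
        by (simp add: \<rho>)
      then have "lift (f a - f u') w' a"
        using lift_scale[OF w'(2), of "1 / \<kappa>"] \<kappa> by simp
      moreover have "f w' = f u' + (1 - \<kappa>) *\<^sub>R (f a - f u')"
        using eq by (simp add: scaleR_diff_left algebra_simps)
      then have "step (f a - f u') u' w'"
        using u' w' V \<kappa> by (intro stepI[of V _ _ "1 - \<kappa>"]) auto
      ultimately show ?thesis
        using u' by (meson converse_rtranclp_into_rtranclp)
    qed
    moreover have "\<epsilon> > 0" "\<epsilon> \<le> 1"
      using \<epsilon>1 \<epsilon>2 \<mu> by (auto simp: \<epsilon>_def)
    ultimately show ?thesis
      by blast
  qed
qed

subsection \<open>Any two points are linked\<close>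

text \<open>Along the segment from \<open>f u\<close> to \<open>f w\<close> the set of parameters of points linked to \<open>a\<close> is closed,
and tilting extends it to the right of each of its elements, so its supremum is 1.\<close>

lemma linked_good:
  assumes U: "good U" "u \<in> U" "w \<in> U" and au: "linked a u"
  shows "linked a w"
proof -
  define S where "S = {y. linked a y}"
  define p where "p = (\<lambda>t::real. f u + t *\<^sub>R (f w - f u))"
  have a: "a \<in> topspace X"
    using au linked_topspace by blast
  \<comment> \<open>A zero step inside \<open>U\<close> carries a lift over to any other point of
    \<open>U\<close> with the same value.\<close>
  have inv: "linked a z'" if z: "linked a z" "z \<in> U" "z' \<in> U" "f z = f z'" for z z'
  proof -
    have "lift (f a - f z) z a"
      using z linked_sym linked_imp_lift by blast
    moreover have "step (f a - f z) z' z"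
      using U z by (intro stepI[of U _ _ 0]) auto
    ultimately have "lift (f a - f z) z' a"
      by simp
    then show ?thesis
      using lift_imp_linked linked_sym good_topspace U z by blast
  qed
  have pU: "p t \<in> f ` U" if t: "t \<in> {0..1}" for t
    using convex_add_scaleR[of "f ` U" "f u" 1 "f w - f u" t] U good_convex[of U] t
    by (auto simp: p_def)
  define T where "T = {t \<in> {0..1}. p t \<in> f ` (U \<inter> S)}"
  \<comment> \<open>The image of \<open>U - S\<close> is relatively open and, by \<open>inv\<close>,
    complementary to the image of \<open>U \<inter> S\<close>, which is therefore relatively
    closed.\<close>
  have "openin X (U - S)"
    using closedin_linked U by (simp add: S_def good_openin openin_diff)
  then have "openin (top_of_set (f ` U)) (f ` (U - S))"
    using U good_open_image by blast
  moreover have "f ` U - f ` (U - S) = f ` (U \<inter> S)"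
  proof -
    have "f ` (U - S) \<inter> f ` (U \<inter> S) = {}"
      using inv by (auto simp: S_def)
    then show ?thesis
      by blast
  qed
  ultimately have "closedin (top_of_set (f ` U)) (f ` (U \<inter> S))"
    using closedin_diff[OF closedin_topspace] by fastforce
  moreover have "continuous_on {0..1} p"
    by (auto simp: p_def intro!: continuous_intros)
  ultimately have "closedin (top_of_set {0..1}) ({0..1} \<inter> p -` (f ` (U \<inter> S)))"
    using pU by (intro continuous_closedin_preimage_gen) auto
  moreover have "{0..1} \<inter> p -` (f ` (U \<inter> S)) = T"
    by (auto simp: T_def)
  ultimately have "closed T"
    using closedin_closed_trans[of "{0..1}" T] by simp
  have "0 \<in> T"
    using au U by (auto simp: T_def p_def S_def)
  have bdd: "bdd_above T"
    by (rule bdd_aboveI[of _ 1]) (auto simp: T_def)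
  define t where "t = Sup T"
  have "t \<in> T"
    unfolding t_def using \<open>closed T\<close> \<open>0 \<in> T\<close> bdd closed_contains_Sup by blast
  then obtain z where z: "z \<in> U" "linked a z" "f z = p t" and t: "0 \<le> t" "t \<le> 1"
    by (auto simp: T_def S_def)
  have "t = 1"
  proof (rule ccontr)
    assume "t \<noteq> 1"
    \<comment> \<open>Tilting in the direction of the remaining piece \<open>p 1 - p t\<close> leads
      to points over the same segment with larger parameter.\<close>
    have eq: "p t + \<theta> *\<^sub>R (p 1 - p t) = p (t + \<theta> * (1 - t))" for \<theta>
      by (simp add: p_def algebra_simps)
    have "f z + (p 1 - p t) \<in> f ` U"
      using z pU[of 1] by simp
    from lift_tilt[OF linked_imp_lift[OF linked_sym[OF z(2)]] U(1) z(1) this]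
    obtain \<epsilon> where "\<epsilon> > 0" "\<epsilon> \<le> 1" and \<epsilon>: "\<forall>\<theta>. 0 \<le> \<theta> \<and> \<theta> \<le> \<epsilon> \<longrightarrow>
        (\<exists>u'\<in>U. f u' = f z + \<theta> *\<^sub>R (p 1 - p t) \<and> lift (f a - f u') u' a)"
      by blast
    then have "\<exists>u'\<in>U. f u' = f z + \<epsilon> *\<^sub>R (p 1 - p t) \<and> lift (f a - f u') u' a"
      by simp
    then obtain u' where u': "u' \<in> U" "f u' = p (t + \<epsilon> * (1 - t))" "lift (f a - f u') u' a"
      unfolding z(3) eq by blast
    then have "linked a u'"
      using linked_sym[OF lift_imp_linked[OF u'(3) good_topspace[OF U(1) u'(1)]]] by simp
    moreover have "\<epsilon> * (1 - t) \<le> 1 - t"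
      using \<open>\<epsilon> \<le> 1\<close> \<open>\<epsilon> > 0\<close> t by (simp add: mult_left_le_one_le)
    moreover have "\<epsilon> * (1 - t) > 0"
      using \<open>\<epsilon> > 0\<close> t \<open>t \<noteq> 1\<close> by simp
    ultimately have "t + \<epsilon> * (1 - t) \<in> T"
      using u'(1) t by (auto simp: T_def S_def simp flip: u'(2))
    then have "t + \<epsilon> * (1 - t) \<le> t"
      unfolding t_def using bdd cSup_upper by blast
    then show False
      using \<open>\<epsilon> * (1 - t) > 0\<close> by simp
  qed
  then have "f z = f w"
    using z by (simp add: p_def)
  then show ?thesis
    using inv z U by blast
qed

section \<open>Consequences of connectedness: fibers and image\<close>

context
  assumes connected: "connected_space X"
begin

lemma all_linked:
  assumes "x \<in> topspace X" "y \<in> topspace X"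
  shows "linked x y"
proof -
  let ?S = "{y. linked x y}"
  have "openin X ?S"
  proof (subst openin_subopen, safe)
    fix u assume u: "linked x u"
    then obtain U where "good U" "u \<in> U"
      using good_exists linked_topspace[OF u] by blast
    then show "\<exists>T. openin X T \<and> u \<in> T \<and> T \<subseteq> {y. linked x y}"
      using linked_good[of U u _ x] good_openin u by (intro exI[of _ U]) auto
  qed
  moreover have "x \<in> ?S"
    using assms by (simp add: linked_def over_def)
  ultimately have "?S = topspace X"
    using connected closedin_linked unfolding connected_space_clopen_in by blast
  then show ?thesis
    using assms by blast
qed

lemma same_if_eq: "x \<in> topspace X \<Longrightarrow> y \<in> topspace X \<Longrightarrow> f x = f y \<Longrightarrow> x \<bowtie> y"
  using all_linked linked_same by blast

lemma connectedin_fiber: "connectedin X (fiber X f v)"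
proof -
  have "connected_space (subtopology X (fiber X f v))"
    unfolding connected_space_iff_connected_component
  proof (intro ballI)
    fix x y assume "x \<in> topspace (subtopology X (fiber X f v))" "y \<in> topspace (subtopology X (fiber X f v))"
    then have "x \<in> topspace X" "y \<in> topspace X" "f x = v" "f y = v"
      by (auto simp: fiber_def)
    then show "connected_component_of (subtopology X (fiber X f v)) x y"
      using same_if_eq[of x y] by (simp add: same_fiber_component_iff)
  qed
  then show ?thesis
    by (auto simp: connectedin_def fiber_def)
qed

text \<open>With connected fibers, the preimage of the image of \<open>U\<close> is its
  saturation.\<close>

lemma openin_preimage_image:
  assumes "openin X U"
  shows "openin X {x \<in> topspace X. f x \<in> f ` U}"
proof -
  have "{x \<in> topspace X. f x \<in> f ` U} = saturation U"
  proof
    show "{x \<in> topspace X. f x \<in> f ` U} \<subseteq> saturation U"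
    proof
      fix x assume "x \<in> {x \<in> topspace X. f x \<in> f ` U}"
      then obtain u where u: "x \<in> topspace X" "u \<in> U" "f x = f u"
        by auto
      then have "u \<bowtie> x"
        using same_if_eq[of u x] openin_subset[OF assms] by auto
      then show "x \<in> saturation U"
        using u(2) by (auto simp: saturation_def)
    qed
    show "saturation U \<subseteq> {x \<in> topspace X. f x \<in> f ` U}"
      using image_saturation[of U] openin_subset[OF openin_saturation[OF assms]] by blast
  qed
  then show ?thesis
    using openin_saturation[OF assms] by simp
qed

text \<open>By convexity of the good sets in the chain, a lift covers every point between its end
  values, not only the values at its nodes.\<close>

lemma convex_image: "convex (f ` topspace X)"
  unfolding convex_contains_segment
proof clarify
  fix x y p assume xy: "x \<in> topspace X" "y \<in> topspace X" and p: "p \<in> closed_segment (f x) (f y)"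
  have *: "\<exists>r\<ge>0. f u = f x + r *\<^sub>R v \<and> (\<forall>s. 0 \<le> s \<and> s \<le> r \<longrightarrow> f x + s *\<^sub>R v \<in> f ` topspace X)"
    if "lift v x u" for v u
    using that
  proof (induction rule: rtranclp_induct)
    case base
    then show ?case
      using xy by (intro exI[of _ 0]) auto
  next
    case (step y z)
    obtain V t where V: "good V" "y \<in> V" "z \<in> V" "0 \<le> t" "f z = f y + t *\<^sub>R v"
      using step.hyps by (auto simp: step_def)
    obtain r where r: "r \<ge> 0" "f y = f x + r *\<^sub>R v"
        "\<And>s. 0 \<le> s \<Longrightarrow> s \<le> r \<Longrightarrow> f x + s *\<^sub>R v \<in> f ` topspace X"
      using step.IH by blast
    have fz: "f z = f x + (r + t) *\<^sub>R v"
      using V r by (simp add: algebra_simps)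
    have "f x + s *\<^sub>R v \<in> f ` topspace X" if s: "0 \<le> s" "s \<le> r + t" for s
    proof (cases "s \<le> r")
      case False
      have "f y \<in> f ` V" "f y + t *\<^sub>R v \<in> f ` V"
        using V(2,3) by (simp_all flip: V(5))
      then have "f y + (s - r) *\<^sub>R v \<in> f ` V"
        by (rule convex_add_scaleR[OF good_convex[OF V(1)]]) (use s False in simp_all)
      then have "f x + s *\<^sub>R v \<in> f ` V"
        by (simp add: r algebra_simps)
      then show ?thesis
        using good_topspace[OF V(1)] by blast
    qed (use r s in auto)
    then show ?case
      using fz r V by (intro exI[of _ "r + t"]) auto
  qed
  \<comment> \<open>If \<open>f y = f x\<close>, the direction vanishes and \<open>r\<close> is
    undetermined; otherwise \<open>r = 1\<close> and the lift covers the whole segment.\<close>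
  have "f y - f x = 0 \<or> f x + s *\<^sub>R (f y - f x) \<in> f ` topspace X" if s: "0 \<le> s" "s \<le> 1" for s
  proof -
    obtain r where r: "f y = f x + r *\<^sub>R (f y - f x)"
      "\<forall>s. 0 \<le> s \<and> s \<le> r \<longrightarrow> f x + s *\<^sub>R (f y - f x) \<in> f ` topspace X"
      using *[OF linked_imp_lift[OF all_linked[OF xy]]] by blast
    have "(r - 1) *\<^sub>R (f y - f x) = 0"
      using r(1) by (auto simp: algebra_simps)
    then show ?thesis
      using r(2) s by auto
  qed
  moreover obtain s where "0 \<le> s" "s \<le> 1" "p = f x + s *\<^sub>R (f y - f x)"
    using p by (auto simp: closed_segment_def algebra_simps)
  ultimately show "p \<in> f ` topspace X"
    using xy by (metis add.right_neutral imageI scaleR_zero_right)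
qed

end

end

subsection \<open>The weak-star topology\<close>

text \<open>Evaluation at a vector is norm continuous, so the generating sets are norm open.\<close>

lemma openin_weak_star_imp_open:
  fixes S :: "('w::real_normed_vector \<Rightarrow>\<^sub>L real) set"
  assumes "openin weak_star_topology S"
  shows "open S"
proof -
  have "generate_topology_on {{v::'w \<Rightarrow>\<^sub>L real. blinfun_apply v w \<in> U} | w U. open U} S"
    using assms by (simp add: weak_star_topology_def openin_topology_generated_by_iff)
  then show ?thesis
  proof induction
    case (Basis s)
    then obtain w U where s: "s = (\<lambda>v. blinfun_apply v w) -` U" "open U"
      by auto
    then show ?case
      by (auto intro!: open_vimage continuous_intros)
  qed auto
qed

lemma topspace_weak_star [simp]: "topspace weak_star_topology = UNIV"
proof -
  have "openin weak_star_topology (UNIV :: ('a \<Rightarrow>\<^sub>L real) set)"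
    unfolding weak_star_topology_def
    by (rule topology_generated_by_Basis) (auto intro: exI[of _ UNIV])
  then show ?thesis
    using openin_subset by blast
qed

text \<open>By (VN) the image of a small neighborhood contains a ball around the vertex within the
  cone. Restricting to the preimage of that ball makes the image exactly ball intersected with cone,
  which is convex; (LFC) passes to the smaller set.\<close>

lemma local_convexity_data_chart:
  assumes cont: "continuous_map X euclidean f" and "local_convexity_data X f"
    and "locally_fiber_connected X f" and x: "x \<in> topspace X"
  shows "\<exists>U. chart X f U \<and> x \<in> U"
proof -
  obtain N where N: "openin X N" "x \<in> N" and data: "(\<forall>U. openin X U \<and> x \<in> U \<and> U \<subseteq> N \<longrightarrow>
      (\<exists>C. is_convex_cone_with_vertex C (f x) \<and> f ` U \<subseteq> C \<and> nhd_in C (f ` U) (f x) \<and>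
        (\<forall>G. openin (subtopology X U) G \<longrightarrow> openin (top_of_set C) (f ` G)) \<and>
        (\<forall>U'. U' \<subseteq> U \<and> nhd_of X U' x \<longrightarrow> nhd_in C (f ` U') (f x))))"
    using bspec[OF assms(2)[unfolded local_convexity_data_def] x] by (elim exE conjE) (rule that)
  obtain A where A: "A \<subseteq> N" "nhd_of X A x" "LFC X f A"
    using assms(3)[unfolded locally_fiber_connected_def, rule_format, OF x conjI[OF N]] by blast
  then obtain U where U: "openin X U" "x \<in> U" "U \<subseteq> A"
    by (auto simp: nhd_of_def)
  then have "openin X U \<and> x \<in> U \<and> U \<subseteq> N"
    using A(1) by blast
  from mp[OF spec[OF data] this] obtain C
    where "is_convex_cone_with_vertex C (f x)" and C: "f ` U \<subseteq> C" "nhd_in C (f ` U) (f x)"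
      "\<forall>G. openin (subtopology X U) G \<longrightarrow> openin (top_of_set C) (f ` G)"
    by (elim exE conjE) (rule that)
  then have "convex C"
    by (simp add: is_convex_cone_with_vertex_def)
  from C(2) obtain T where T: "open T" "f x \<in> T" "T \<inter> C \<subseteq> f ` U"
    by (auto simp: nhd_in_def)
  then obtain r where r: "r > 0" "ball (f x) r \<subseteq> T"
    using openE by blast
  define U' where "U' = {z \<in> U. f z \<in> ball (f x) r}"
  have U': "openin X U'"
    unfolding U'_def
    by (rule openin_continuous_map_preimage_gen[OF cont U(1)]) simp
  have "f ` U' = ball (f x) r \<inter> C"
    using C(1) T(3) r(2) by (force simp: U'_def)
  then have "convex (f ` U')"
    using \<open>convex C\<close> by (simp add: convex_Int)
  moreover have "openin (top_of_set (f ` U')) (f ` G)" if G: "openin X G" "G \<subseteq> U'" for G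
  proof -
    have "openin (subtopology X U) G"
      using G by (auto simp: U'_def openin_subtopology intro!: exI[of _ G])
    then show ?thesis
      using C(3) G \<open>f ` U' = _\<close> openin_subset_trans[of C "f ` G" "f ` U'"] by blast
  qed
  moreover have "same_fiber_component X f u w" if uw: "u \<in> U'" "w \<in> U'" "f u = f w" for u w
    by (rule LFC_same_fiber_component[OF A(3)]) (use uw U openin_subset[OF U(1)] in \<open>auto simp: U'_def\<close>)
  moreover have "x \<in> U'"
    using U r by (simp add: U'_def)
  ultimately show ?thesis
    using U' unfolding chart_def by blast
qed

theorem theorem2p30:
  fixes X :: "'a topology" and f :: "'a \<Rightarrow> ('w::banach \<Rightarrow>\<^sub>L real)"
  assumes "connected_space X" and "locally_connected_space X" and "Hausdorff_space X"
    and "first_countable X" and "normal_space X"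
    and "continuous_map X euclidean f"
    and "local_convexity_data X f"
    and "locally_fiber_connected X f"
    and "closed_map X weak_star_topology f"
  shows "(\<forall>v. connectedin X (fiber X f v))
     \<and> open_map X (subtopology weak_star_topology (f ` topspace X)) f
     \<and> closedin weak_star_topology (f ` topspace X) \<and> convex (f ` topspace X)"
proof -
  have "closed (f ` A)" if "closedin X A" for A
  proof -
    have "closedin weak_star_topology (f ` A)"
      using assms(9) that by (simp add: closed_map_def)
    then show ?thesis
      using openin_weak_star_imp_open by (simp add: closedin_def closed_def Compl_eq_Diff_UNIV)
  qed
  then have "closed_map X euclidean f"
    by (simp add: closed_map_def)
  then interpret locally_convex_closed_map X f
    using assms(5,6) local_convexity_data_chart[OF assms(6-8)] by unfold_locales
  have "openin (subtopology weak_star_topology (f ` topspace X)) (f ` U)" if U: "openin X U" for U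
  proof -
    \<comment> \<open>The complement of a saturated set: its image is disjoint from the image of
      \<open>U\<close>, and the two together make up the whole image of \<open>f\<close>.\<close>
    define A where "A = topspace X - {x \<in> topspace X. f x \<in> f ` U}"
    have "closedin X A"
      unfolding A_def using openin_preimage_image[OF assms(1) U] by blast
    then have "openin weak_star_topology (- f ` A)"
      using assms(9) by (auto simp: closed_map_def closedin_def Compl_eq_Diff_UNIV)
    moreover have "f ` U = - f ` A \<inter> f ` topspace X"
      using openin_subset[OF U] unfolding A_def by blast
    ultimately show ?thesis
      by (auto simp: openin_subtopology)
  qed
  then show ?thesis
    using connectedin_fiber[OF assms(1)] convex_image[OF assms(1)] assms(9)
    by (auto simp: open_map_def closed_map_def)
qed

end
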